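(* Let $X,Y$ be Banach lattices, let $p\in[1,\infty)$, let $\mathbb{T}=(T(t))_{t\ge0}$ be a positive $C_0$-semigroup on $X$ with generator $A$, and let $C\in\mathcal{L}(D(A),Y)$ be a positive operator. Suppose that for some $\alpha>0$ there is a constant $\gamma>0$ such that $$\int_0^\alpha\Vert CT(t)x\Vert^p\,dt\ \le\ \gamma^p\Vert x\Vert^p\qquad\text{for all }x\in D(A)\text{ with }x\ge0 .$$ Then $C$ is an $L^p$-admissible (positive) observation operator for $A$.
   Context: $D(A)$ carries the graph norm. $C\in\mathcal{L}(D(A),Y)$ is positive if $Cx\in Y_+$ for all $x\in D(A)\cap X_+$. $C\in\mathcal{L}(D(A),Y)$ is an $L^p$-admissible observation operator for $A$ if for some (hence all) $\alpha>0$ there is a constant $\gamma=\gamma(\alpha)>0$ such that $\int_0^\alpha\Vert CT(t)x\Vert^p\,dt\le\gamma^p\Vert x\Vert^p$ for all $x\in D(A)$. *)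

theory Defs
  imports "HOL-Analysis.Analysis" "HOL-Library.Lattice_Algebras"
begin

text \<open>
  Real Banach lattices. The parent classes supply completeness, compatibility of the order with
  the vector space structure, the lattice operations and \<open>\<bar>x\<bar> = sup x (- x)\<close>.
\<close>

class banach_lattice = banach + ordered_real_vector + lattice_ab_group_add_abs +
  assumes norm_mono_abs: "\<bar>x\<bar> \<le> \<bar>y\<bar> \<Longrightarrow> norm x \<le> norm y"

instance real :: banach_lattice
  by standard simp

text \<open>
  Semigroups are indexed by \<^typ>\<open>real\<close>; only the values at \<open>t \<ge> 0\<close> matter.
\<close>

definition C0_semigroup :: "(real \<Rightarrow> 'a::banach \<Rightarrow>\<^sub>L 'a) \<Rightarrow> bool" where
  "C0_semigroup T \<longleftrightarrow>
     T 0 = id_blinfun \<and>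
     (\<forall>s\<ge>0. \<forall>t\<ge>0. T (s + t) = T s o\<^sub>L T t) \<and>
     (\<forall>x. ((\<lambda>t. T t x) \<longlongrightarrow> x) (at_right 0))"

definition positive_semigroup :: "(real \<Rightarrow> 'a::banach_lattice \<Rightarrow>\<^sub>L 'a) \<Rightarrow> bool" where
  "positive_semigroup T \<longleftrightarrow> (\<forall>t\<ge>0. \<forall>x\<ge>0. 0 \<le> T t x)"

text \<open>
  An unbounded operator is given by its domain \<open>D\<close> and a function \<open>A\<close>, whose values outside \<open>D\<close>
  are irrelevant.
\<close>

definition is_generator ::
  "(real \<Rightarrow> 'a::banach \<Rightarrow>\<^sub>L 'a) \<Rightarrow> 'a set \<Rightarrow> ('a \<Rightarrow> 'a) \<Rightarrow> bool" where
  "is_generator T D A \<longleftrightarrow>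
     D = {x. \<exists>y. ((\<lambda>h. (T h x - x) /\<^sub>R h) \<longlongrightarrow> y) (at_right 0)} \<and>
     (\<forall>x\<in>D. ((\<lambda>h. (T h x - x) /\<^sub>R h) \<longlongrightarrow> A x) (at_right 0))"

definition graph_norm :: "('a::real_normed_vector \<Rightarrow> 'a) \<Rightarrow> 'a \<Rightarrow> real" where
  "graph_norm A x = norm x + norm (A x)"

text \<open>
  Membership of \<open>C\<close> in \<open>L(D(A), Y)\<close>, where \<open>D(A)\<close> carries the graph norm. It is meant for
  \<open>D\<close> a linear subspace, as the domain of a generator is.
\<close>

definition bounded_on_domain ::
  "'a::real_normed_vector set \<Rightarrow> ('a \<Rightarrow> 'a) \<Rightarrow> ('a \<Rightarrow> 'b::real_normed_vector) \<Rightarrow> bool" where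
  "bounded_on_domain D A C \<longleftrightarrow>
     (\<forall>x\<in>D. \<forall>y\<in>D. C (x + y) = C x + C y) \<and>
     (\<forall>r. \<forall>x\<in>D. C (r *\<^sub>R x) = r *\<^sub>R C x) \<and>
     (\<exists>K. \<forall>x\<in>D. norm (C x) \<le> K * graph_norm A x)"

definition positive_on_domain ::
  "'a::banach_lattice set \<Rightarrow> ('a \<Rightarrow> 'b::banach_lattice) \<Rightarrow> bool" where
  "positive_on_domain D C \<longleftrightarrow> (\<forall>x\<in>D. 0 \<le> x \<longrightarrow> 0 \<le> C x)"

text \<open>
  The integral is the Lebesgue integral with values in \<open>[0, \<infinity>]\<close>, so that the estimate
  includes its finiteness. The condition for one \<open>\<alpha> > 0\<close> is equivalent to that for all of them.
\<close>

definition Lp_admissible ::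
  "real \<Rightarrow> (real \<Rightarrow> 'a::banach \<Rightarrow>\<^sub>L 'a) \<Rightarrow> 'a set \<Rightarrow> ('a \<Rightarrow> 'a) \<Rightarrow> ('a \<Rightarrow> 'b::banach) \<Rightarrow> bool" where
  "Lp_admissible p T D A C \<longleftrightarrow>
     is_generator T D A \<and> bounded_on_domain D A C \<and>
     (\<exists>\<alpha>>0. \<exists>\<gamma>>0. \<forall>x\<in>D.
        (\<integral>\<^sup>+t\<in>{0..\<alpha>}. ennreal (norm (C (T t x)) powr p) \<partial>lborel)
          \<le> ennreal (\<gamma> powr p * norm x powr p))"

end

theory Submission
  imports Defs
begin

text \<open>
  An element \<open>x\<close> of the domain need not be a difference of positive elements of the domain whose
  norms are controlled by that of \<open>x\<close>. Its orbit averages \<open>x\<^sub>h = (1/h) \<integral>\<^sub>0\<^sup>h T(s)x ds\<close> are: they equal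
  \<open>(x\<^sup>+)\<^sub>h - (x\<^sup>-)\<^sub>h\<close>, where both terms are positive, lie in the domain and have norm at most
  \<open>M \<parallel>x\<parallel>\<close>. Since \<open>x\<^sub>h \<rightarrow> x\<close> in the graph norm, \<open>\<parallel>C T(t)(x - x\<^sub>h)\<parallel> \<le> \<parallel>x\<parallel>\<close> holds for
  all \<open>t\<close> in \<open>[0, \<alpha>]\<close> once \<open>h\<close> is small, and the estimate for positive elements transfers to \<open>x\<close>.
\<close>

section \<open>Strongly continuous semigroups\<close>

lemma C0_semigroup_zero: "C0_semigroup T \<Longrightarrow> T 0 x = x"
  by (simp add: C0_semigroup_def)

lemma C0_semigroup_add:
  "C0_semigroup T \<Longrightarrow> 0 \<le> s \<Longrightarrow> 0 \<le> t \<Longrightarrow> T (s + t) x = T s (T t x)"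
  by (simp add: C0_semigroup_def)

lemma C0_semigroup_tendsto: "C0_semigroup T \<Longrightarrow> ((\<lambda>t. T t x) \<longlongrightarrow> x) (at_right 0)"
  by (simp add: C0_semigroup_def)

lemma eventually_at_right_0_iff:
  "eventually P (at_right (0::real)) \<longleftrightarrow> (\<exists>d>0. \<forall>t. 0 < t \<and> t < d \<longrightarrow> P t)"
  by (auto simp: eventually_at_right_field)

text \<open>
  Uniform boundedness: the orbits are bounded near \<open>0\<close>, so by Baire some set of points whose
  orbits are uniformly bounded there contains a ball.
\<close>

lemma C0_semigroup_bounded_near_0:
  assumes T: "C0_semigroup T"
  obtains d M where "0 < d" "\<And>t. 0 \<le> t \<Longrightarrow> t \<le> d \<Longrightarrow> norm (T t) \<le> M"
proof -
  \<comment> \<open>One index both shortens the time interval and raises the bound, so that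
    countably many closed sets cover the space.\<close>
  define F where "F n = {x. \<forall>t\<in>{0..1 / real (Suc n)}. norm (T t x) \<le> real (Suc n)}" for n
  have F_closed: "closed (F n)" for n
  proof -
    have "F n = (\<Inter>t\<in>{0..1 / real (Suc n)}. {x. norm (T t x) \<le> real (Suc n)})"
      by (auto simp: F_def)
    then show ?thesis
      by (auto intro!: closed_INT closed_Collect_le continuous_intros)
  qed
  have cover: "\<exists>n. x \<in> F n" for x
  proof -
    have "eventually (\<lambda>t. dist (T t x) x < 1) (at_right 0)"
      using C0_semigroup_tendsto[OF T] by (rule tendstoD) simp
    then obtain d where d: "0 < d" "\<And>t. 0 < t \<Longrightarrow> t < d \<Longrightarrow> dist (T t x) x < 1"
      unfolding eventually_at_right_0_iff by auto
    \<comment> \<open>The term \<open>1 / d\<close> puts the interval of \<open>F n\<close> inside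
      the range where the orbit stays within distance 1 of \<open>x\<close>; the term
      \<open>norm x + 1\<close> is the bound that this gives.\<close>
    obtain n :: nat where n: "max (norm x + 1) (1 / d) < real n"
      using reals_Archimedean2 by blast
    have bound: "norm (T t x) \<le> real (Suc n)" if "t \<in> {0..1 / real (Suc n)}" for t
    proof (cases "t = 0")
      case True
      then show ?thesis using n C0_semigroup_zero[OF T] by simp
    next
      case False
      have "1 / real (Suc n) < d"
        using n d(1) by (simp add: field_simps)
      then have "dist (T t x) x < 1"
        using that False by (intro d(2)) auto
      then show ?thesis
        using n norm_triangle_ineq2[of "T t x" x] by (simp add: dist_norm)
    qed
    then have "x \<in> F n" unfolding F_def by blast
    then show ?thesis ..
  qed
  have "\<exists>n. interior (F n) \<noteq> {}"
  proof (rule ccontr)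
    assume "\<not> (\<exists>n. interior (F n) \<noteq> {})"
    then have "Met_TC.mtopology interior_of \<Union>(range F) = {}"
      using F_closed
      by (intro Met_TC.metric_Baire_category_alt) (auto simp: complete_UNIV)
    moreover have "\<Union>(range F) = UNIV" using cover by auto
    ultimately show False by simp
  qed
  then obtain n z where "z \<in> interior (F n)" by blast
  then obtain e where e: "0 < e" "cball z e \<subseteq> F n"
    unfolding mem_interior_cball by blast
  define d where "d = 1 / real (Suc n)"
  \<comment> \<open>A vector of length \<open>e\<close> is the difference of two points of the ball,
    and the orbit of each is bounded by \<open>Suc n\<close>. Rescaling divides by
    \<open>e\<close>.\<close>
  define M where "M = 2 * real (Suc n) / e"
  have "norm (T t) \<le> M" if t: "0 \<le> t" "t \<le> d" for t
  proof (rule norm_blinfun_bound)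
    show "0 \<le> M" using e by (simp add: M_def)
    fix x
    show "norm (T t x) \<le> M * norm x"
    proof (cases "x = 0")
      case False
      define y where "y = z + (e / norm x) *\<^sub>R x"
      have "y \<in> F n" "z \<in> F n"
        using e False by (auto simp: y_def dist_norm intro!: subsetD[OF e(2)])
      then have "norm (T t y) \<le> real (Suc n)" "norm (T t z) \<le> real (Suc n)"
        using t unfolding F_def d_def by auto
      then have "norm (T t y - T t z) \<le> 2 * real (Suc n)"
        using norm_triangle_ineq4[of "T t y" "T t z"] by simp
      moreover have "T t y - T t z = (e / norm x) *\<^sub>R T t x"
        by (simp add: y_def blinfun.bilinear_simps)
      ultimately have "(e / norm x) * norm (T t x) \<le> 2 * real (Suc n)"
        using e by simp
      then show ?thesis using e False by (simp add: M_def field_simps)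
    qed (simp add: blinfun.bilinear_simps)
  qed
  moreover have "0 < d" by (simp add: d_def)
  ultimately show ?thesis by (rule that[rotated])
qed

text \<open>The semigroup law reaches \<open>b\<close> in finitely many steps of length
  \<open>d\<close>, each costing a factor \<open>M\<close>. Making the factor at least 1 lets the
  same power cover the shorter times too, and later allows division by it.\<close>

lemma C0_semigroup_locally_bounded:
  assumes T: "C0_semigroup T"
  obtains M where "1 \<le> M" "\<And>t x. 0 \<le> t \<Longrightarrow> t \<le> b \<Longrightarrow> norm (T t x) \<le> M * norm x"
proof -
  obtain d M0 where d: "0 < d" and M0: "\<And>t. 0 \<le> t \<Longrightarrow> t \<le> d \<Longrightarrow> norm (T t) \<le> M0"
    using C0_semigroup_bounded_near_0[OF T] by blast
  define M where "M = max 1 M0"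
  have M1: "1 \<le> M" by (simp add: M_def)
  have step: "norm (T t x) \<le> M * norm x" if "0 \<le> t" "t \<le> d" for t x
  proof -
    have "norm (T t) * norm x \<le> M * norm x"
      using M0[OF that] by (intro mult_right_mono) (auto simp: M_def)
    then show ?thesis using norm_blinfun[of "T t" x] by simp
  qed
  have iter: "0 \<le> t \<Longrightarrow> t \<le> real (Suc n) * d \<Longrightarrow> norm (T t x) \<le> M ^ Suc n * norm x" for n t x
  proof (induction n arbitrary: t)
    case 0
    then show ?case using step by simp
  next
    case (Suc n)
    show ?case
    proof (cases "t \<le> d")
      case True
      have "norm (T t x) \<le> M * norm x" using step Suc True by simp
      also have "\<dots> \<le> M ^ Suc (Suc n) * norm x"
        using M1 by (intro mult_right_mono self_le_power) auto
      finally show ?thesis .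
    next
      case False
      have "T t x = T d (T (t - d) x)"
        using C0_semigroup_add[OF T, of d "t - d"] False d by simp
      then have "norm (T t x) \<le> M * norm (T (t - d) x)"
        using step d by simp
      also have "\<dots> \<le> M * (M ^ Suc n * norm x)"
        using Suc False M1 by (intro mult_left_mono Suc.IH) (auto simp: algebra_simps)
      finally show ?thesis by (simp add: mult_ac)
    qed
  qed
  obtain n :: nat where n: "b / d < real n"
    using reals_Archimedean2 by blast
  have "b \<le> real (Suc n) * d"
    using n d by (simp add: field_simps)
  then have "norm (T t x) \<le> M ^ Suc n * norm x" if "0 \<le> t" "t \<le> b" for t x
    using iter that by force
  moreover have "1 \<le> M ^ Suc n" using M1 by (rule one_le_power)
  ultimately show ?thesis by (rule that[rotated])
qed

text \<open>For \<open>u < v\<close> the increment is \<open>T u (T (v - u) x - x)\<close>, so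
  continuity on either side of \<open>s\<close> follows from right continuity at 0, given a bound
  for \<open>T u\<close> that is uniform near \<open>s\<close>. Keeping the times below
  \<open>s + 1\<close> provides that bound.\<close>

lemma C0_semigroup_continuous_on:
  assumes T: "C0_semigroup T"
  shows "continuous_on {0..} (\<lambda>t. T t x)"
proof -
  have "\<exists>d>0. \<forall>t\<in>{0..}. dist t s < d \<longrightarrow> dist (T t x) (T s x) < e"
    if s: "0 \<le> s" and e: "0 < e" for s e
  proof -
    obtain M where M: "1 \<le> M"
      and bd: "\<And>t x. 0 \<le> t \<Longrightarrow> t \<le> s + 1 \<Longrightarrow> norm (T t x) \<le> M * norm x"
      using C0_semigroup_locally_bounded[OF T] by blast
    have "eventually (\<lambda>t. dist (T t x) x < e / M) (at_right 0)"
      using C0_semigroup_tendsto[OF T] e M by (intro tendstoD) auto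
    then obtain d where d: "0 < d" "\<And>t. 0 < t \<Longrightarrow> t < d \<Longrightarrow> dist (T t x) x < e / M"
      unfolding eventually_at_right_0_iff by auto
    have *: "norm (T v x - T u x) < e" if "0 \<le> u" "u < v" "v \<le> s + 1" "v - u < d" for u v
    proof -
      have "T v x - T u x = T u (T (v - u) x - x)"
        using C0_semigroup_add[OF T, of u "v - u" x] that by (simp add: blinfun.diff_right)
      then have "norm (T v x - T u x) \<le> M * norm (T (v - u) x - x)"
        using bd[of u] that by simp
      also have "\<dots> < M * (e / M)"
        using d(2)[of "v - u"] that M by (intro mult_strict_left_mono) (auto simp: dist_norm)
      finally show ?thesis using M by simp
    qed
    have "dist (T t x) (T s x) < e" if "0 \<le> t" "dist t s < min d 1" for t
      using *[of s t] *[of t s] that s e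
      by (cases t s rule: linorder_cases) (auto simp: dist_norm norm_minus_commute)
    then show ?thesis
      using d(1) by (intro exI[of _ "min d 1"]) auto
  qed
  then show ?thesis
    unfolding continuous_on_iff by simp
qed

lemma C0_semigroup_continuous_on_interval:
  "C0_semigroup T \<Longrightarrow> 0 \<le> a \<Longrightarrow> continuous_on {a..b} (\<lambda>t. T t x)"
  by (rule continuous_on_subset[OF C0_semigroup_continuous_on]) auto

lemma tendsto_integral_average:
  fixes f :: "real \<Rightarrow> 'a::banach"
  assumes f: "continuous_on {a..} f"
  shows "((\<lambda>r. integral {a..a + r} f /\<^sub>R r) \<longlongrightarrow> f a) (at_right 0)"
proof (rule tendstoI)
  fix e :: real assume e: "0 < e"
  \<comment> \<open>Half of \<open>e\<close>, because bounding the integral gives only a weak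
    inequality.\<close>
  then obtain d where d: "0 < d" "\<And>t. a \<le> t \<Longrightarrow> dist t a < d \<Longrightarrow> dist (f t) (f a) < e / 2"
    using f unfolding continuous_on_iff
    by (metis atLeast_iff half_gt_zero order_refl)
  have "dist (integral {a..a + r} f /\<^sub>R r) (f a) < e" if r: "0 < r" "r < d" for r
  proof -
    have c: "continuous_on {a..a + r} f"
      by (rule continuous_on_subset[OF f]) auto
    have "integral {a..a + r} (\<lambda>t. f t - f a) = integral {a..a + r} f - r *\<^sub>R f a"
      using r integral_diff[OF integrable_continuous_real[OF c] integrable_const_ivl, of "f a"] by simp
    moreover have "norm (integral {a..a + r} (\<lambda>t. f t - f a)) \<le> e / 2 * (a + r - a)"
      using r d(2) c
      by (intro integral_bound) (auto intro!: continuous_intros less_imp_le simp: dist_norm)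
    ultimately have "norm (integral {a..a + r} f - r *\<^sub>R f a) \<le> e / 2 * r" by simp
    moreover have "integral {a..a + r} f /\<^sub>R r - f a = (integral {a..a + r} f - r *\<^sub>R f a) /\<^sub>R r"
      using r by (simp add: algebra_simps)
    ultimately have "dist (integral {a..a + r} f /\<^sub>R r) (f a) \<le> e / 2"
      using r by (simp only: dist_norm norm_scaleR) (simp add: field_simps)
    then show ?thesis using e by simp
  qed
  then show "\<forall>\<^sub>F r in at_right 0. dist (integral {a..a + r} f /\<^sub>R r) (f a) < e"
    unfolding eventually_at_right_0_iff using d(1) by blast
qed

section \<open>Generators\<close>

lemma is_generatorI:
  assumes "is_generator T D A" "((\<lambda>h. (T h x - x) /\<^sub>R h) \<longlongrightarrow> y) (at_right 0)"
  shows "x \<in> D" "A x = y"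
proof -
  show "x \<in> D" using assms by (auto simp: is_generator_def)
  then show "A x = y"
    using assms unfolding is_generator_def
    by (meson tendsto_unique trivial_limit_at_right_real)
qed

lemma is_generatorD:
  "is_generator T D A \<Longrightarrow> x \<in> D \<Longrightarrow> ((\<lambda>h. (T h x - x) /\<^sub>R h) \<longlongrightarrow> A x) (at_right 0)"
  by (simp add: is_generator_def)

lemma is_generator_diff:
  assumes "is_generator T D A" "x \<in> D" "y \<in> D"
  shows "x - y \<in> D" "A (x - y) = A x - A y"
proof -
  have "((\<lambda>h. (T h x - x) /\<^sub>R h - (T h y - y) /\<^sub>R h) \<longlongrightarrow> A x - A y) (at_right 0)"
    using assms by (intro tendsto_diff is_generatorD)
  then have "((\<lambda>h. (T h (x - y) - (x - y)) /\<^sub>R h) \<longlongrightarrow> A x - A y) (at_right 0)"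
    by (simp add: blinfun.bilinear_simps algebra_simps)
  then show "x - y \<in> D" "A (x - y) = A x - A y"
    using is_generatorI[OF assms(1)] by blast+
qed

lemma is_generator_scaleR:
  assumes "is_generator T D A" "x \<in> D"
  shows "r *\<^sub>R x \<in> D" "A (r *\<^sub>R x) = r *\<^sub>R A x"
proof -
  have "((\<lambda>h. r *\<^sub>R ((T h x - x) /\<^sub>R h)) \<longlongrightarrow> r *\<^sub>R A x) (at_right 0)"
    using assms by (intro tendsto_intros is_generatorD)
  then have "((\<lambda>h. (T h (r *\<^sub>R x) - r *\<^sub>R x) /\<^sub>R h) \<longlongrightarrow> r *\<^sub>R A x) (at_right 0)"
    by (simp add: blinfun.bilinear_simps algebra_simps)
  then show "r *\<^sub>R x \<in> D" "A (r *\<^sub>R x) = r *\<^sub>R A x"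
    using is_generatorI[OF assms(1)] by blast+
qed

text \<open>\<open>T t\<close> commutes with \<open>T h\<close>, so it maps the difference quotient
  of \<open>x\<close> to that of \<open>T t x\<close>, and being continuous it preserves the
  limit.\<close>

lemma is_generator_semigroup:
  assumes T: "C0_semigroup T" and G: "is_generator T D A" and x: "x \<in> D" and t: "0 \<le> t"
  shows "T t x \<in> D" "A (T t x) = T t (A x)"
proof -
  have "((\<lambda>h. T t ((T h x - x) /\<^sub>R h)) \<longlongrightarrow> T t (A x)) (at_right 0)"
    using is_generatorD[OF G x] by (intro tendsto_intros)
  moreover have "eventually (\<lambda>h. T t ((T h x - x) /\<^sub>R h) = (T h (T t x) - T t x) /\<^sub>R h) (at_right 0)"
    unfolding eventually_at_right_0_iff
    using C0_semigroup_add[OF T t, of _ x] C0_semigroup_add[OF T _ t, of _ x]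
    by (intro exI[of _ 1]) (auto simp: blinfun.bilinear_simps add.commute)
  ultimately have "((\<lambda>h. (T h (T t x) - T t x) /\<^sub>R h) \<longlongrightarrow> T t (A x)) (at_right 0)"
    by (rule Lim_transform_eventually)
  then show "T t x \<in> D" "A (T t x) = T t (A x)"
    using is_generatorI[OF G] by blast+
qed

section \<open>Orbit averages and their convergence in the graph norm\<close>

definition orbit_average :: "(real \<Rightarrow> 'a::banach \<Rightarrow>\<^sub>L 'a) \<Rightarrow> real \<Rightarrow> 'a \<Rightarrow> 'a" where
  "orbit_average T h x = integral {0..h} (\<lambda>s. T s x) /\<^sub>R h"

text \<open>Applying \<open>T r\<close> shifts the window of integration to
  \<open>{r..h + r}\<close>. Splitting \<open>{0..h + r}\<close> once at \<open>r\<close> and once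
  at \<open>h\<close> leaves two end pieces of length \<open>r\<close>, whichever of
  \<open>r\<close> and \<open>h\<close> is larger.\<close>

lemma semigroup_integral_diff:
  assumes T: "C0_semigroup T" and h: "0 \<le> h" and r: "0 \<le> r"
  shows "T r (integral {0..h} (\<lambda>s. T s x)) - integral {0..h} (\<lambda>s. T s x)
    = integral {h..h + r} (\<lambda>s. T s x) - integral {0..r} (\<lambda>s. T s x)"
proof -
  let ?f = "\<lambda>s. T s x"
  have int: "?f integrable_on {a..b}" if "0 \<le> a" for a b
    using T that by (intro integrable_continuous_real C0_semigroup_continuous_on_interval)
  have "T r (integral {0..h} ?f) = integral {0..h} (\<lambda>s. T r (T s x))"
    using integral_linear[OF int blinfun.bounded_linear_right, of 0 h "T r"] by (simp add: o_def)
  also have "\<dots> = integral {0..h} (\<lambda>s. ?f (s + r))"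
    using C0_semigroup_add[OF T r] by (intro integral_cong) (auto simp: add.commute)
  also have "\<dots> = integral {r..h + r} ?f"
    using has_integral_affinity[OF integrable_integral[OF int, of r "h + r", folded cbox_interval], of 1 r] r h
    by (auto intro!: integral_unique simp: image_affinity_cbox)
  finally show ?thesis
    using Henstock_Kurzweil_Integration.integral_combine[of 0 r "h + r" ?f]
      Henstock_Kurzweil_Integration.integral_combine[of 0 h "h + r" ?f] int r h
    by (simp add: algebra_simps)
qed

text \<open>Divided by \<open>r\<close>, the two end pieces are averages that converge to the orbit
  at times \<open>h\<close> and 0. Here \<open>x\<close> is arbitrary, so the averages of its
  positive and negative parts lie in the domain even if these parts do not.\<close>

lemma orbit_average_generator:
  assumes T: "C0_semigroup T" and G: "is_generator T D A" and h: "0 < h"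
  shows "orbit_average T h x \<in> D" "A (orbit_average T h x) = (T h x - x) /\<^sub>R h"
proof -
  let ?f = "\<lambda>s. T s x" and ?I = "integral {0..h} (\<lambda>s. T s x)"
  have c: "continuous_on {a..} ?f" if "0 \<le> a" for a
    by (rule continuous_on_subset[OF C0_semigroup_continuous_on[OF T]]) (use that in auto)
  have "((\<lambda>r. integral {h..h + r} ?f /\<^sub>R r - integral {0..0 + r} ?f /\<^sub>R r) \<longlongrightarrow> T h x - T 0 x)
      (at_right 0)"
    using h c by (intro tendsto_diff tendsto_integral_average) auto
  moreover have "eventually (\<lambda>r. integral {h..h + r} ?f /\<^sub>R r - integral {0..0 + r} ?f /\<^sub>R r
      = (T r ?I - ?I) /\<^sub>R r) (at_right 0)"
    unfolding eventually_at_right_0_iff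
    using semigroup_integral_diff[OF T, of h _ x] h
    by (intro exI[of _ 1]) (auto simp: scaleR_diff_right)
  ultimately have "((\<lambda>r. (T r ?I - ?I) /\<^sub>R r) \<longlongrightarrow> T h x - T 0 x) (at_right 0)"
    by (rule Lim_transform_eventually)
  from is_generatorI[OF G this] show "orbit_average T h x \<in> D"
    "A (orbit_average T h x) = (T h x - x) /\<^sub>R h"
    using is_generator_scaleR[OF G, of ?I "inverse h"] C0_semigroup_zero[OF T]
    by (auto simp: orbit_average_def)
qed

lemma orbit_average_diff:
  assumes T: "C0_semigroup T"
  shows "orbit_average T h (x - y) = orbit_average T h x - orbit_average T h y"
proof -
  have int: "(\<lambda>s. T s z) integrable_on {0..h}" for z
    using T by (intro integrable_continuous_real C0_semigroup_continuous_on_interval) auto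
  show ?thesis
    using integral_diff[OF int int, of x y]
    by (simp add: orbit_average_def blinfun.bilinear_simps scaleR_diff_right)
qed

lemma orbit_average_norm_le:
  assumes T: "C0_semigroup T" and h: "0 < h"
    and M: "\<And>t. 0 \<le> t \<Longrightarrow> t \<le> h \<Longrightarrow> norm (T t x) \<le> M"
  shows "norm (orbit_average T h x) \<le> M"
proof -
  have "norm (integral {0..h} (\<lambda>s. T s x)) \<le> M * (h - 0)"
    using h M T by (intro integral_bound C0_semigroup_continuous_on_interval) auto
  then show ?thesis using h by (simp add: orbit_average_def field_simps)
qed

text \<open>On the average \<open>A\<close> takes the value of the difference quotient of
  \<open>x\<close> itself, which tends to \<open>A x\<close> exactly because \<open>x\<close> is in
  the domain.\<close>

lemma orbit_average_tendsto_graph_norm: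
  assumes T: "C0_semigroup T" and G: "is_generator T D A" and x: "x \<in> D"
  shows "((\<lambda>h. graph_norm A (x - orbit_average T h x)) \<longlongrightarrow> 0) (at_right 0)"
proof -
  have "((\<lambda>h. orbit_average T h x) \<longlongrightarrow> x) (at_right 0)"
    using tendsto_integral_average[OF C0_semigroup_continuous_on[OF T], of x] C0_semigroup_zero[OF T]
    by (simp add: orbit_average_def)
  then have "((\<lambda>h. norm (x - orbit_average T h x) + norm (A x - (T h x - x) /\<^sub>R h))
      \<longlongrightarrow> norm (x - x) + norm (A x - A x)) (at_right 0)"
    using is_generatorD[OF G x] by (intro tendsto_intros)
  then have lim: "((\<lambda>h. norm (x - orbit_average T h x) + norm (A x - (T h x - x) /\<^sub>R h))
      \<longlongrightarrow> 0) (at_right 0)" by simp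
  have ev: "eventually (\<lambda>h. norm (x - orbit_average T h x) + norm (A x - (T h x - x) /\<^sub>R h)
      = graph_norm A (x - orbit_average T h x)) (at_right 0)"
    unfolding eventually_at_right_0_iff
    using is_generator_diff(2)[OF G x orbit_average_generator(1)[OF T G]]
      orbit_average_generator(2)[OF T G]
    by (intro exI[of _ 1]) (auto simp: graph_norm_def)
  show ?thesis by (rule Lim_transform_eventually[OF lim ev])
qed

section \<open>Banach lattices\<close>

text \<open>The positive part of \<open>- l\<close> is the obstruction to \<open>0 \<le> l\<close>.
  It is dominated by \<open>\<bar>f n - l\<bar>\<close> for every positive \<open>f n\<close>, so
  its norm is at most the distance from \<open>f n\<close> to \<open>l\<close>.\<close>

lemma closed_nonneg_banach_lattice: "closed {x :: 'a::banach_lattice. 0 \<le> x}"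
  unfolding closed_sequential_limits
proof (intro allI impI, elim conjE)
  fix f :: "nat \<Rightarrow> 'a" and l
  assume f: "\<forall>n. f n \<in> {x. 0 \<le> x}" and l: "f \<longlonglongrightarrow> l"
  have "norm (pprt (- l)) \<le> norm (f n - l)" for n
  proof (rule norm_mono_abs)
    have "- l \<le> f n - l" "0 \<le> \<bar>f n - l\<bar>" using f by auto
    moreover have "f n - l \<le> \<bar>f n - l\<bar>" by (rule abs_ge_self)
    ultimately have "pprt (- l) \<le> \<bar>f n - l\<bar>"
      unfolding pprt_def by (meson le_supI order_trans)
    then show "\<bar>pprt (- l)\<bar> \<le> \<bar>f n - l\<bar>" by (simp add: abs_of_nonneg)
  qed
  moreover have "(\<lambda>n. norm (f n - l)) \<longlonglongrightarrow> 0"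
    using l by (simp add: LIM_zero_iff tendsto_norm_zero)
  ultimately have "norm (pprt (- l)) \<le> 0"
    by (intro tendsto_lowerbound[of "\<lambda>n. norm (f n - l)"]) auto
  then have "- l \<le> 0"
    by (simp add: le_zero_iff_zero_pprt)
  then show "l \<in> {x. 0 \<le> x}" by simp
qed

text \<open>Riemann sums of a positive function are positive, and the integral is in the closure of
  the positive cone, which is closed.\<close>

lemma integral_nonneg_banach_lattice:
  fixes f :: "real \<Rightarrow> 'a::banach_lattice"
  assumes f: "f integrable_on {a..b}" and nonneg: "\<And>t. t \<in> {a..b} \<Longrightarrow> 0 \<le> f t"
  shows "0 \<le> integral {a..b} f"
proof -
  have "integral {a..b} f \<in> closure {x. 0 \<le> x}"
    unfolding closure_approachable
  proof (intro allI impI)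
    fix e :: real assume "0 < e"
    then obtain g where g: "gauge g" and
      sums: "\<And>p. p tagged_division_of cbox a b \<Longrightarrow> g fine p \<Longrightarrow>
        norm ((\<Sum>(x, k)\<in>p. measure lborel k *\<^sub>R f x) - integral {a..b} f) < e"
      using integrable_integral[OF f, folded cbox_interval, unfolded has_integral] by auto
    obtain p where p: "p tagged_division_of cbox a b" "g fine p"
      using fine_division_exists[OF g] by blast
    have "0 \<le> (\<Sum>(x, k)\<in>p. measure lborel k *\<^sub>R f x)"
    proof (rule sum_nonneg)
      fix z assume z: "z \<in> p"
      obtain x k where xk: "z = (x, k)" by force
      have "x \<in> {a..b}"
        using tag_in_interval[OF p(1)] z xk by auto
      then show "0 \<le> (case z of (x, k) \<Rightarrow> measure lborel k *\<^sub>R f x)"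
        using nonneg by (simp add: xk scaleR_nonneg_nonneg)
    qed
    then show "\<exists>y\<in>{x. 0 \<le> x}. dist y (integral {a..b} f) < e"
      using sums[OF p] by (auto simp: dist_norm)
  qed
  then show ?thesis
    by (simp add: closure_closed[OF closed_nonneg_banach_lattice])
qed

lemma orbit_average_nonneg:
  assumes T: "C0_semigroup T" "positive_semigroup T" and x: "0 \<le> x" and h: "0 \<le> h"
  shows "0 \<le> orbit_average T h x"
proof -
  have "0 \<le> integral {0..h} (\<lambda>s. T s x)"
    using T x
    by (intro integral_nonneg_banach_lattice integrable_continuous_real
        C0_semigroup_continuous_on_interval) (auto simp: positive_semigroup_def)
  then show ?thesis using h by (simp add: orbit_average_def scaleR_nonneg_nonneg)
qed

lemma norm_pprt_le: "norm (pprt x) \<le> norm (x :: 'a::banach_lattice)"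
proof (rule norm_mono_abs)
  have "pprt x \<le> \<bar>x\<bar>"
    unfolding pprt_def by (simp add: abs_ge_self)
  then show "\<bar>pprt x\<bar> \<le> \<bar>x\<bar>" by (simp add: abs_of_nonneg)
qed

lemma norm_nprt_le: "norm (nprt x) \<le> norm (x :: 'a::banach_lattice)"
  using norm_pprt_le[of "- x"] by (simp add: pprt_neg)

section \<open>Observation operators\<close>

lemma bounded_on_domain_diff:
  assumes G: "is_generator T D A" and C: "bounded_on_domain D A C" and xy: "x \<in> D" "y \<in> D"
  shows "C (x - y) = C x - C y"
proof -
  have "C (x - y) + C y = C ((x - y) + y)"
    using C xy is_generator_diff(1)[OF G xy] unfolding bounded_on_domain_def by metis
  then show ?thesis by (simp add: algebra_simps)
qed

text \<open>The constant is made positive so that one can divide by it; enlarging it is harmless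
  because the graph norm is nonnegative.\<close>

lemma bounded_on_domain_bound:
  assumes "bounded_on_domain D A C"
  obtains K where "0 < K" "\<And>x. x \<in> D \<Longrightarrow> norm (C x) \<le> K * graph_norm A x"
proof -
  obtain K where K: "\<forall>x\<in>D. norm (C x) \<le> K * graph_norm A x"
    using assms unfolding bounded_on_domain_def by blast
  have "norm (C x) \<le> max K 1 * graph_norm A x" if "x \<in> D" for x
    using K that mult_right_mono[of K "max K 1" "graph_norm A x"]
    by (force simp: graph_norm_def)
  then show ?thesis by (intro that[of "max K 1"]) auto
qed

lemma graph_norm_semigroup:
  assumes "C0_semigroup T" "is_generator T D A" "x \<in> D" "0 \<le> t"
    and "\<And>x. norm (T t x) \<le> M * norm x"
  shows "graph_norm A (T t x) \<le> M * graph_norm A x"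
  using assms(5)[of x] assms(5)[of "A x"] is_generator_semigroup(2)[OF assms(1-4)]
  by (simp add: graph_norm_def distrib_left)

text \<open>This supplies measurability of the integrands. \<open>C\<close> is continuous only for
  the graph norm, but \<open>A (T t x) = T t (A x)\<close> is again an orbit, so the orbit of
  \<open>x\<close> is continuous in that norm.\<close>

lemma observation_continuous_on:
  assumes T: "C0_semigroup T" and G: "is_generator T D A" and C: "bounded_on_domain D A C"
    and x: "x \<in> D"
  shows "continuous_on {0..} (\<lambda>t. C (T t x))"
proof -
  obtain K where K: "0 < K" "\<And>x. x \<in> D \<Longrightarrow> norm (C x) \<le> K * graph_norm A x"
    using bounded_on_domain_bound[OF C] by blast
  have "((\<lambda>t. C (T t x)) \<longlongrightarrow> C (T s x)) (at s within {0..})" if s: "0 \<le> s" for s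
  proof (rule LIM_zero_cancel, rule Lim_null_comparison)
    have c: "((\<lambda>t. T t y) \<longlongrightarrow> T s y) (at s within {0..})" for y
      using C0_semigroup_continuous_on[OF T, of y] s by (simp add: continuous_on_def)
    have "((\<lambda>t. K * (norm (T t x - T s x) + norm (T t (A x) - T s (A x)))) \<longlongrightarrow>
       K * (norm (T s x - T s x) + norm (T s (A x) - T s (A x)))) (at s within {0..})"
      by (intro tendsto_intros c)
    then show "((\<lambda>t. K * (norm (T t x - T s x) + norm (T t (A x) - T s (A x)))) \<longlongrightarrow> 0)
        (at s within {0..})" by simp
    have "norm (C (T t x) - C (T s x)) \<le> K * (norm (T t x - T s x) + norm (T t (A x) - T s (A x)))"
      if t: "0 \<le> t" for t
    proof -
      note st = is_generator_semigroup[OF T G x s] is_generator_semigroup[OF T G x t]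
      show ?thesis
        using K(2)[OF is_generator_diff(1)[OF G st(3,1)]] is_generator_diff(2)[OF G st(3,1)] st
          bounded_on_domain_diff[OF G C st(3,1)]
        by (simp add: graph_norm_def)
    qed
    then show "\<forall>\<^sub>F t in at s within {0..}. norm (C (T t x) - C (T s x))
        \<le> K * (norm (T t x - T s x) + norm (T t (A x) - T s (A x)))"
      by (auto simp: eventually_at_filter intro!: always_eventually)
  qed
  then show ?thesis by (simp add: continuous_on_def)
qed

text \<open>The sum is at most three times its largest term, whose power occurs on the right. A
  crude factor suffices, since admissibility asks only for some constant.\<close>

lemma powr_add3_le:
  fixes a b c p :: real
  assumes "0 \<le> a" "0 \<le> b" "0 \<le> c" "0 \<le> p"
  shows "(a + b + c) powr p \<le> 3 powr p * (a powr p + b powr p + c powr p)"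
proof -
  define m where "m = max a (max b c)"
  have "(a + b + c) powr p \<le> (3 * m) powr p"
    using assms by (intro powr_mono2) (auto simp: m_def)
  also have "\<dots> = 3 powr p * m powr p"
    using assms by (simp add: powr_mult m_def)
  also have "m powr p \<le> a powr p + b powr p + c powr p"
    by (auto simp: m_def max_def)
  finally show ?thesis by simp
qed

section \<open>Transfer of the estimate from positive elements to the whole domain\<close>

theorem lemma3p1:
  fixes T :: "real \<Rightarrow> 'a::banach_lattice \<Rightarrow>\<^sub>L 'a"
    and D :: "'a set"
    and A :: "'a \<Rightarrow> 'a"
    and C :: "'a \<Rightarrow> 'b::banach_lattice"
    and p \<alpha> \<gamma> :: real
  assumes "1 \<le> p"
    and "C0_semigroup T"
    and "positive_semigroup T"
    and "is_generator T D A"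
    and "bounded_on_domain D A C"
    and "positive_on_domain D C"
    and "0 < \<alpha>"
    and "0 < \<gamma>"
    and "\<And>x. x \<in> D \<Longrightarrow> 0 \<le> x \<Longrightarrow>
           (\<integral>\<^sup>+t\<in>{0..\<alpha>}. ennreal (norm (C (T t x)) powr p) \<partial>lborel)
             \<le> ennreal (\<gamma> powr p * norm x powr p)"
  shows "Lp_admissible p T D A C \<and> positive_on_domain D C"
proof -
  note T = assms(2) and G = assms(4) and C = assms(5) and adm = assms(9)
  have p: "0 < p" using assms(1) by simp
  obtain M where M1: "1 \<le> M"
    and M: "\<And>t x. 0 \<le> t \<Longrightarrow> t \<le> \<alpha> \<Longrightarrow> norm (T t x) \<le> M * norm x"
    using C0_semigroup_locally_bounded[OF T] by blast
  obtain K where K: "0 < K" "\<And>x. x \<in> D \<Longrightarrow> norm (C x) \<le> K * graph_norm A x"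
    using bounded_on_domain_bound[OF C] by blast
  \<comment> \<open>The doubled term comes from the two positive averages, and
    \<open>\<alpha>\<close> from integrating the constant error bound. The factor 3 in
    \<open>\<gamma>'\<close> absorbs the one from \<open>powr_add3_le\<close>.\<close>
  define L where "L = 2 * (\<gamma> powr p * M powr p) + \<alpha>"
  define \<gamma>' where "\<gamma>' = 3 * L powr (1 / p)"
  have L: "0 < L" using assms(7) by (simp add: L_def add_nonneg_pos)
  have \<gamma>': "0 < \<gamma>'" using L by (simp add: \<gamma>'_def)
  have \<gamma>'p: "\<gamma>' powr p = 3 powr p * L"
    using L p by (simp add: \<gamma>'_def powr_mult powr_powr)
  have "(\<integral>\<^sup>+t\<in>{0..\<alpha>}. ennreal (norm (C (T t x)) powr p) \<partial>lborel)
      \<le> ennreal (\<gamma>' powr p * norm x powr p)" if x: "x \<in> D" for x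
  proof (cases "x = 0")
    case True
    have "C 0 = 0" using bounded_on_domain_diff[OF G C x x] by simp
    then show ?thesis using True p by simp
  next
    case False
    \<comment> \<open>Chosen so that \<open>K * (M * e) = norm x\<close>. It is positive only for
      nonzero \<open>x\<close>, whence the case split.\<close>
    define e where "e = norm x / (K * M)"
    have e: "0 < e" using False K M1 by (simp add: e_def)
    have "eventually (\<lambda>h. dist (graph_norm A (x - orbit_average T h x)) 0 < e) (at_right 0)"
      using orbit_average_tendsto_graph_norm[OF T G x] e by (rule tendstoD)
    then obtain d where d: "0 < d"
      "\<And>h. 0 < h \<Longrightarrow> h < d \<Longrightarrow> graph_norm A (x - orbit_average T h x) < e"
      unfolding eventually_at_right_0_iff by (auto simp: graph_norm_def)
    \<comment> \<open>Besides closeness, \<open>h \<le> \<alpha>\<close> is required so that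
      \<open>M\<close> bounds the orbits over the averaging window.\<close>
    define h where "h = min (d / 2) \<alpha>"
    have h: "0 < h" "h < d" "h \<le> \<alpha>" using d(1) assms(7) by (auto simp: h_def)
    define u where "u = orbit_average T h (pprt x)"
    \<comment> \<open>\<open>nprt x\<close> is \<open>inf x 0\<close>, so the positive element to
      average is its negative.\<close>
    define v where "v = orbit_average T h (- nprt x)"
    have D: "u \<in> D" "v \<in> D" "u - v \<in> D" "x - (u - v) \<in> D"
      using orbit_average_generator(1)[OF T G h(1)] is_generator_diff(1)[OF G] x
      by (auto simp: u_def v_def)
    have pos: "0 \<le> u" "0 \<le> v"
      using orbit_average_nonneg[OF T assms(3)] h(1) by (auto simp: u_def v_def)
    have nrm: "norm u \<le> M * norm x" "norm v \<le> M * norm x"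
    proof -
      have "norm (orbit_average T h y) \<le> M * norm x" if "norm y \<le> norm x" for y
        using h M M1 that
        by (intro orbit_average_norm_le[OF T h(1)])
          (meson mult_left_mono order_trans order.trans[OF zero_le_one])
      then show "norm u \<le> M * norm x" "norm v \<le> M * norm x"
        using norm_pprt_le[of x] norm_nprt_le[of x] by (auto simp: u_def v_def)
    qed
    have uv: "u - v = orbit_average T h x"
      using orbit_average_diff[OF T, of h "pprt x" "- nprt x"] by (simp add: u_def v_def flip: prts)
    \<comment> \<open>One \<open>h\<close> serves all times, since \<open>T t\<close> enlarges the
      graph norm by at most the factor \<open>M\<close>.\<close>
    have close: "norm (C (T t (x - (u - v)))) \<le> norm x" if "0 \<le> t" "t \<le> \<alpha>" for t
    proof -
      have "norm (C (T t (x - (u - v)))) \<le> K * graph_norm A (T t (x - (u - v)))"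
        using that D by (intro K is_generator_semigroup[OF T G])
      also have "\<dots> \<le> K * (M * graph_norm A (x - (u - v)))"
        using that D K(1) M by (intro mult_left_mono graph_norm_semigroup[OF T G]) auto
      also have "\<dots> \<le> K * (M * e)"
        using d(2)[OF h(1,2)] K(1) M1 uv by (intro mult_left_mono) auto
      also have "\<dots> = norm x" using K(1) M1 by (simp add: e_def)
      finally show ?thesis .
    qed
    have pw: "norm (C (T t x)) powr p \<le>
        3 powr p * (norm (C (T t u)) powr p + norm (C (T t v)) powr p + norm x powr p)"
      if t: "0 \<le> t" "t \<le> \<alpha>" for t
    proof -
      have TD: "T t y \<in> D" if "y \<in> D" for y
        by (rule is_generator_semigroup[OF T G that t(1)])
      have "C (T t (x - (u - v))) = C (T t x) - (C (T t u) - C (T t v))"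
        using bounded_on_domain_diff[OF G C] is_generator_diff(1)[OF G] TD D x
        by (simp add: blinfun.diff_right)
      then have eq: "C (T t x) = C (T t u) - C (T t v) + C (T t (x - (u - v)))" by simp
      have "norm (C (T t x)) \<le> norm (C (T t u)) + norm (C (T t v)) + norm x"
        unfolding eq
        using close[OF t] norm_triangle_ineq4[of "C (T t u)" "C (T t v)"]
          norm_triangle_ineq[of "C (T t u) - C (T t v)" "C (T t (x - (u - v)))"] by argo
      then have "norm (C (T t x)) powr p \<le> (norm (C (T t u)) + norm (C (T t v)) + norm x) powr p"
        using p by (intro powr_mono2) auto
      also have "\<dots> \<le> 3 powr p * (norm (C (T t u)) powr p + norm (C (T t v)) powr p + norm x powr p)"
        using p by (intro powr_add3_le) auto
      finally show ?thesis .
    qed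
    let ?J = "\<lambda>y. \<integral>\<^sup>+t\<in>{0..\<alpha>}. ennreal (norm (C (T t y)) powr p) \<partial>lborel"
    \<comment> \<open>Additivity of the integral requires measurability. Continuity on the interval
      is enough because the indicator cuts off the rest.\<close>
    have meas: "(\<lambda>t. ennreal (norm (C (T t y)) powr p) * indicator {0..\<alpha>} t) \<in> borel_measurable lborel"
      if y: "y \<in> D" for y
    proof -
      have "continuous_on {0..\<alpha>} (\<lambda>t. C (T t y))"
        by (rule continuous_on_subset[OF observation_continuous_on[OF T G C y]]) auto
      then have "continuous_on {0..\<alpha>} (\<lambda>t. norm (C (T t y)) powr p)"
        using p by (intro continuous_on_powr' continuous_intros) auto
      then have "(\<lambda>t. norm (C (T t y)) powr p) \<in> borel_measurable (restrict_space borel {0..\<alpha>})"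
        by (rule borel_measurable_continuous_on_restrict)
      then have "(\<lambda>t. ennreal (norm (C (T t y)) powr p)) \<in> borel_measurable (restrict_space borel {0..\<alpha>})"
        by measurable
      then show ?thesis
        by (subst (asm) borel_measurable_restrict_space_iff_ennreal) auto
    qed
    have bnd: "?J y \<le> ennreal (\<gamma> powr p * (M powr p * norm x powr p))"
      if "y \<in> D" "0 \<le> y" "norm y \<le> M * norm x" for y
    proof -
      have "norm y powr p \<le> (M * norm x) powr p"
        using that p by (intro powr_mono2) auto
      also have "\<dots> = M powr p * norm x powr p"
        using M1 by (simp add: powr_mult)
      finally show ?thesis
        using adm[OF that(1,2)]
        by (meson ennreal_leI mult_left_mono order_trans powr_ge_zero)
    qed
    \<comment> \<open>The indicator is kept on the constant term as well, so that this term
      integrates to a finite multiple of \<open>\<alpha>\<close>.\<close>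
    have "?J x \<le> (\<integral>\<^sup>+t. ennreal (3 powr p) *
        (ennreal (norm (C (T t u)) powr p) * indicator {0..\<alpha>} t
        + ennreal (norm (C (T t v)) powr p) * indicator {0..\<alpha>} t
        + ennreal (norm x powr p) * indicator {0..\<alpha>} t) \<partial>lborel)"
    proof (rule nn_integral_mono)
      fix t :: real
      show "ennreal (norm (C (T t x)) powr p) * indicator {0..\<alpha>} t \<le> ennreal (3 powr p) *
        (ennreal (norm (C (T t u)) powr p) * indicator {0..\<alpha>} t
        + ennreal (norm (C (T t v)) powr p) * indicator {0..\<alpha>} t
        + ennreal (norm x powr p) * indicator {0..\<alpha>} t)"
        using pw[of t]
        by (auto simp: indicator_def simp flip: ennreal_plus ennreal_mult intro!: ennreal_leI)
    qed
    also have "\<dots> = ennreal (3 powr p) * (?J u + ?J v + ennreal (norm x powr p) * ennreal \<alpha>)"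
      using meas[OF D(1)] meas[OF D(2)] assms(7)
      by (simp add: nn_integral_cmult nn_integral_add nn_integral_cmult_indicator)
    also have "\<dots> \<le> ennreal (3 powr p) * (ennreal (\<gamma> powr p * (M powr p * norm x powr p))
        + ennreal (\<gamma> powr p * (M powr p * norm x powr p)) + ennreal (norm x powr p) * ennreal \<alpha>)"
      using D pos nrm by (intro mult_left_mono add_mono bnd) auto
    also have "\<dots> = ennreal (\<gamma>' powr p * norm x powr p)"
      unfolding \<gamma>'p L_def using assms(7)
      by (simp add: algebra_simps flip: ennreal_plus ennreal_mult)
    finally show ?thesis .
  qed
  then show ?thesis
    \<comment> \<open>The interval length stays \<open>\<alpha>\<close>; only the constant changes,
      to \<open>\<gamma>'\<close>.\<close>
    unfolding Lp_admissible_def using G C assms(6,7) \<gamma>' by blast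
qed

end
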